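(* Let $p=(p_1,\dots,p_a)$ be a probability vector with all $p_s>0$, and let $X_{k,n}^{p}$ denote the number of nodes with exactly $k$ descendants in a $p$-biased recursive tree of order $n$. Then $$\mathbb{E}[X_{k,n}^{p}] = (n-k-1)\sum_{s=1}^{a} p_s \left( \Big(\sum_{r=s}^{a} p_r \Big)^k - \Big(\sum_{r=s}^{a} p_r \Big)^{k+1} \right) + \sum_{s=1}^{a} p_s \Big(\sum_{r=s}^{a} p_r \Big)^{k+1}.$$ Moreover, if $X_{k,n}^{a}$ is the number of nodes with exactly $k$ descendants in an $a$-recursive tree of order $n$, then $$\mathbb{E}[X_{k,n}^{a}] = (n-k-1) \left( \frac{1}{a^{k+1}} \sum_{s=1}^{a} s^k - \frac{1}{a^{k+2}} \sum_{s=1}^{a} s^{k+1}\right) + \frac{1}{a^{k+2}} \sum_{s=1}^{a} s^{k+1},$$ and asymptotically $$\mathbb{E}[X_{k,n}^{a}] \xrightarrow[a \to \infty]{} \frac{n}{(k+1)(k+2)}.$$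
   Context: $p$-biased riffle shuffle of $\{2,\dots,n\}$: start with the deck $2,3,\dots,n$ in increasing order; cut it into $a$ consecutive piles whose sizes $(b_1,\dots,b_a)$ (pile 1 consisting of the $b_1$ smallest cards, etc.) have the multinomial$(n-1;p)$ distribution; then choose uniformly one of the $\binom{n-1}{b_1,\dots,b_a}$ ways of interleaving the piles keeping the cards of each pile in their original order. The resulting arrangement $\gamma=(\gamma(2),\dots,\gamma(n))$ is the $p$-biased riffle shuffle permutation of $\{2,\dots,n\}$, where $\gamma(j)$ is the card in position $j$. $p$-biased recursive tree ($p$-BRT) of order $n$: the random rooted tree on vertices $1,\dots,n$ with root $1$, obtained by attaching each node $i\ge 2$ to the rightmost element $j$ of $\gamma$ which precedes $i$ and satisfies $j<i$; if there is no such $j$, the parent of $i$ is $1$. When $p$ is uniform over $[a]=\{1,\dots,a\}$, $a\ge2$, it is called an $a$-recursive tree ($a$-RT). A descendant of a vertex $v$ is any vertex that is a child of $v$ or a descendant of a child of $v$ (so $v$ is not its own descendant).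
   Formalization: Proved for 0 ≤ k ≤ n−2; the English gives no range for k. For k = n−1 only the root counts, so the expectation is 1, but the formula gives less when a ≥ 2 (n=1, k=0, p=(1/2,1/2) gives 3/4). For k ≥ n the expectation is 0, but the stated limit is positive. *)

theory Defs
  imports "HOL-Probability.Probability" "HOL-Combinatorics.Multiset_Permutations"
begin

definition prob_vector :: "nat \<Rightarrow> (nat \<Rightarrow> real) \<Rightarrow> bool" where
  "prob_vector a p \<longleftrightarrow> (\<forall>s\<in>{1..a}. 0 \<le> p s) \<and> (\<Sum>s=1..a. p s) = 1"

subsection \<open>The multinomial distribution\<close>

text \<open>Vectors \<open>(b\<^sub>1, \<dots>, b\<^sub>a)\<close> are functions vanishing outside \<open>{1..a}\<close>.\<close>

definition count_vectors :: "nat \<Rightarrow> nat \<Rightarrow> (nat \<Rightarrow> nat) set" where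
  "count_vectors a N = {b. (\<forall>s. s \<notin> {1..a} \<longrightarrow> b s = 0) \<and> (\<Sum>s=1..a. b s) = N}"

definition multinomial_mass :: "nat \<Rightarrow> (nat \<Rightarrow> real) \<Rightarrow> nat \<Rightarrow> (nat \<Rightarrow> nat) \<Rightarrow> real" where
  "multinomial_mass a p N b =
     (if b \<in> count_vectors a N
      then fact N / (\<Prod>s=1..a. fact (b s)) * (\<Prod>s=1..a. p s ^ b s) else 0)"

definition multinomial_pmf :: "nat \<Rightarrow> (nat \<Rightarrow> real) \<Rightarrow> nat \<Rightarrow> (nat \<Rightarrow> nat) pmf" where
  "multinomial_pmf a p N = embed_pmf (multinomial_mass a p N)"

lemma count_vectors_0: "count_vectors 0 N = (if N = 0 then {\<lambda>_. 0} else {})"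
  by (auto simp: count_vectors_def)

lemma count_vectors_Suc:
  "count_vectors (Suc a) N = (\<lambda>(i, b). b(Suc a := i)) ` (SIGMA i:{..N}. count_vectors a (N - i))"
proof (intro equalityI subsetI)
  fix b assume b: "b \<in> count_vectors (Suc a) N"
  have s: "(\<Sum>s=1..a. (b(Suc a := 0)) s) = (\<Sum>s=1..a. b s)"
    by (rule sum.cong) auto
  have t: "(\<Sum>s=1..a. b s) + b (Suc a) = N"
    using b by (simp add: count_vectors_def)
  have "(b(Suc a := 0)) \<in> count_vectors a (N - b (Suc a))"
    using b s t unfolding count_vectors_def by auto
  moreover have "b = (b(Suc a := 0))(Suc a := b (Suc a))" by auto
  ultimately show "b \<in> (\<lambda>(i, b). b(Suc a := i)) ` (SIGMA i:{..N}. count_vectors a (N - i))"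
    using t by (intro image_eqI[of _ _ "(b (Suc a), b(Suc a := 0))"]) auto
next
  fix b assume "b \<in> (\<lambda>(i, b). b(Suc a := i)) ` (SIGMA i:{..N}. count_vectors a (N - i))"
  then obtain i c where c: "b = c(Suc a := i)" "i \<le> N" "c \<in> count_vectors a (N - i)" by auto
  have s: "(\<Sum>s=1..a. (c(Suc a := i)) s) = (\<Sum>s=1..a. c s)"
    by (rule sum.cong) auto
  show "b \<in> count_vectors (Suc a) N"
    using c s by (auto simp: count_vectors_def)
qed

lemma inj_count_vectors_Suc:
  "inj_on (\<lambda>(i, b). b(Suc a := i)) (SIGMA i:{..N}. count_vectors a (N - i))"
proof (rule inj_onI, clarify, rule conjI)
  fix i b j c
  assume b: "b \<in> count_vectors a (N - i)" "c \<in> count_vectors a (N - j)"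
    and eq: "b(Suc a := i) = c(Suc a := j)"
  show "i = j" using fun_cong[OF eq, of "Suc a"] by simp
  have "b (Suc a) = 0" "c (Suc a) = 0" using b by (auto simp: count_vectors_def)
  then show "b = c" using eq by (metis fun_upd_triv fun_upd_upd)
qed

lemma finite_count_vectors: "finite (count_vectors a N)"
  by (induction a arbitrary: N) (auto simp: count_vectors_0 count_vectors_Suc)

lemma multinomial_theorem_aux:
  fixes p :: "nat \<Rightarrow> real"
  shows "(\<Sum>b\<in>count_vectors a N. \<Prod>s=1..a. p s ^ b s / fact (b s)) = (\<Sum>s=1..a. p s) ^ N / fact N"
proof (induction a arbitrary: N)
  case 0
  then show ?case by (simp add: count_vectors_0)
next
  case (Suc a)
  let ?f = "\<lambda>a b. \<Prod>s=1..a. p s ^ b s / fact (b s)"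
  have "sum (?f (Suc a)) (count_vectors (Suc a) N)
      = (\<Sum>(i, b)\<in>(SIGMA i:{..N}. count_vectors a (N - i)). ?f (Suc a) (b(Suc a := i)))"
    unfolding count_vectors_Suc
    by (subst sum.reindex[OF inj_count_vectors_Suc]) (simp add: case_prod_beta)
  also have "\<dots> = (\<Sum>i\<le>N. \<Sum>b\<in>count_vectors a (N - i). ?f (Suc a) (b(Suc a := i)))"
    by (subst sum.Sigma) (auto simp: finite_count_vectors)
  also have "\<dots> = (\<Sum>i\<le>N. \<Sum>b\<in>count_vectors a (N - i). ?f a b * (p (Suc a) ^ i / fact i))"
  proof (intro sum.cong refl)
    fix i b
    have "?f a (b(Suc a := i)) = ?f a b" by (rule prod.cong) auto
    then show "?f (Suc a) (b(Suc a := i)) = ?f a b * (p (Suc a) ^ i / fact i)" by simp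
  qed
  also have "\<dots> = (\<Sum>i\<le>N. (p (Suc a) ^ i / fact i) * ((\<Sum>s=1..a. p s) ^ (N - i) / fact (N - i)))"
    by (intro sum.cong refl) (simp only: sum_distrib_right[symmetric] Suc.IH, rule mult.commute)
  also have "\<dots> = (p (Suc a) + (\<Sum>s=1..a. p s)) ^ N / fact N"
    using exp_series_add_commuting[of "p (Suc a)" "\<Sum>s=1..a. p s" N]
    by (simp add: divide_inverse mult.commute)
  finally show ?case by (simp add: add.commute)
qed

lemma multinomial_mass_nonneg: "prob_vector a p \<Longrightarrow> 0 \<le> multinomial_mass a p N b"
  by (auto simp: multinomial_mass_def prob_vector_def intro!: mult_nonneg_nonneg divide_nonneg_nonneg prod_nonneg)

lemma multinomial_mass_sum:
  assumes "prob_vector a p"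
  shows "(\<Sum>b\<in>count_vectors a N. multinomial_mass a p N b) = 1"
proof -
  have "(\<Sum>b\<in>count_vectors a N. multinomial_mass a p N b)
      = (\<Sum>b\<in>count_vectors a N. fact N * (\<Prod>s=1..a. p s ^ b s / fact (b s)))"
    by (intro sum.cong) (auto simp: multinomial_mass_def prod_dividef)
  also have "\<dots> = 1"
    using assms multinomial_theorem_aux[of p a N]
    by (simp add: prob_vector_def flip: sum_distrib_left)
  finally show ?thesis .
qed

lemma pmf_multinomial_pmf:
  assumes "prob_vector a p"
  shows "pmf (multinomial_pmf a p N) b = multinomial_mass a p N b"
  unfolding multinomial_pmf_def
proof (rule pmf_embed_pmf)
  show "0 \<le> multinomial_mass a p N b" for b
    using assms by (rule multinomial_mass_nonneg)
  have "(\<integral>\<^sup>+b. ennreal (multinomial_mass a p N b) \<partial>count_space UNIV)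
      = (\<Sum>b\<in>count_vectors a N. ennreal (multinomial_mass a p N b))"
    by (intro nn_integral_count_space') (auto simp: finite_count_vectors multinomial_mass_def)
  also have "\<dots> = 1"
    using assms by (simp add: multinomial_mass_nonneg multinomial_mass_sum)
  finally show "(\<integral>\<^sup>+b. ennreal (multinomial_mass a p N b) \<partial>count_space UNIV) = 1" .
qed

subsection \<open>The biased riffle shuffle of \<open>{2, \<dots>, n}\<close>\<close>

definition pile :: "(nat \<Rightarrow> nat) \<Rightarrow> nat \<Rightarrow> nat list" where
  "pile b s = [2 + (\<Sum>r=1..<s. b r) ..< 2 + (\<Sum>r=1..s. b r)]"

text \<open>An arrangement \<open>\<gamma>\<close> is the list \<open>[\<gamma>(2), \<dots>, \<gamma>(n)]\<close>. As the cards are distinct, the ways of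
  interleaving the piles correspond to the resulting arrangements.\<close>

definition interleavings :: "nat \<Rightarrow> nat \<Rightarrow> (nat \<Rightarrow> nat) \<Rightarrow> nat list set" where
  "interleavings a n b =
     {\<gamma> \<in> permutations_of_set {2..n}. \<forall>s\<in>{1..a}. filter (\<lambda>c. c \<in> set (pile b s)) \<gamma> = pile b s}"

definition biased_riffle_shuffle :: "nat \<Rightarrow> (nat \<Rightarrow> real) \<Rightarrow> nat \<Rightarrow> nat list pmf" where
  "biased_riffle_shuffle a p n =
     bind_pmf (multinomial_pmf a p (n - 1)) (\<lambda>b. pmf_of_set (interleavings a n b))"

lemma finite_interleavings: "finite (interleavings a n b)"
  by (simp add: interleavings_def)

lemma interleavings_nonempty:
  assumes "b \<in> count_vectors a (n - 1)"
  shows "interleavings a n b \<noteq> {}"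
proof -
  have "filter (\<lambda>c. c \<in> set (pile b s)) [2..<Suc n] = pile b s" if s: "s \<in> {1..a}" for s
  proof (rule sorted_distinct_set_unique)
    have "(\<Sum>r=1..s. b r) \<le> (\<Sum>r=1..a. b r)"
      using s by (intro sum_mono2) auto
    also have "\<dots> = n - 1" using assms by (simp add: count_vectors_def)
    finally show "set (filter (\<lambda>c. c \<in> set (pile b s)) [2..<Suc n]) = set (pile b s)"
      by (auto simp: pile_def)
    show "sorted (filter (\<lambda>c. c \<in> set (pile b s)) [2..<Suc n])"
      by (rule sorted_wrt_filter) (rule sorted_upt)
    show "sorted (pile b s)"
      unfolding pile_def by (rule sorted_upt)
  qed (simp_all add: pile_def)
  then have "[2..<Suc n] \<in> interleavings a n b"
    by (auto simp: interleavings_def permutations_of_set_def)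
  then show ?thesis by auto
qed

subsection \<open>Biased recursive trees\<close>

definition tree_parent :: "nat list \<Rightarrow> nat \<Rightarrow> nat" where
  "tree_parent \<gamma> i =
     (let js = filter (\<lambda>j. j < i) (takeWhile (\<lambda>j. j \<noteq> i) \<gamma>) in if js = [] then 1 else last js)"

text \<open>A rooted tree on \<open>{1..n}\<close> with root \<open>1\<close> is represented by its set of (parent, child) pairs.\<close>

definition recursive_tree :: "nat \<Rightarrow> nat list \<Rightarrow> (nat \<times> nat) set" where
  "recursive_tree n \<gamma> = {(tree_parent \<gamma> i, i) | i. i \<in> {2..n}}"

definition biased_recursive_tree :: "nat \<Rightarrow> (nat \<Rightarrow> real) \<Rightarrow> nat \<Rightarrow> (nat \<times> nat) set pmf" where
  "biased_recursive_tree a p n = map_pmf (recursive_tree n) (biased_riffle_shuffle a p n)"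

definition a_recursive_tree :: "nat \<Rightarrow> nat \<Rightarrow> (nat \<times> nat) set pmf" where
  "a_recursive_tree a n = biased_recursive_tree a (\<lambda>_. 1 / real a) n"

definition descendants :: "(nat \<times> nat) set \<Rightarrow> nat \<Rightarrow> nat set" where
  "descendants T v = {w. (v, w) \<in> T\<^sup>+}"

definition num_with_descendants :: "nat \<Rightarrow> nat \<Rightarrow> (nat \<times> nat) set \<Rightarrow> nat" where
  "num_with_descendants k n T = card {v \<in> {1..n}. card (descendants T v) = k}"

end

theory Submission
  imports Defs
begin

text \<open>
  Write the arrangement \<open>\<gamma>\<close> after the root as the list \<open>1 # \<gamma>\<close>. The descendants of a node \<open>v\<close> are
  the entries of the maximal run of entries larger than \<open>v\<close> directly behind \<open>v\<close>
  (\<open>descendants_recursive_tree\<close>), so nodes with \<open>k\<close> descendants are counted by comparing each entry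
  of \<open>\<gamma>\<close> with those behind it.

  Replace each card by the index of its pile. This turns the interleavings for pile sizes \<open>b\<close> into
  the words with \<open>b s\<close> letters \<open>s\<close>, bijectively (\<open>bij_betw_interleavings_words\<close>). As the multinomial
  mass of \<open>b\<close>, spread evenly over these words, gives each of them the product of the probabilities of
  its letters, the letters are independent with distribution \<open>p\<close>
  (\<open>expectation_biased_riffle_shuffle\<close>). Since piles are kept in order, a card is smaller
  than a card behind it iff its letter is at most the letter of the other
  (\<open>count_runs_interleaving\<close>). The number of nodes with \<open>k\<close> descendants is thus the number of
  positions of a random word followed by exactly \<open>k\<close> letters that are at least the present one and
  then by a smaller letter or the end of the word.

  Let \<open>q s = (\<Sum>r=s..a. p r)\<close>. A position with more than \<open>k\<close> letters behind it has this property with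
  probability \<open>\<Sum>s. p s * (q s ^ k - q s ^ (k + 1))\<close>, and the one with exactly \<open>k\<close> letters behind it
  with probability \<open>\<Sum>s. p s * q s ^ k\<close>. There are \<open>n - k - 2\<close> positions of the first kind, as \<open>\<gamma>\<close> has
  length \<open>n - 1\<close>; the root has \<open>n - 1 > k\<close> descendants and does not contribute.
  Summing gives the formula (\<open>sum_words_count_runs\<close>). For uniform \<open>p\<close> one has
  \<open>q s = (a + 1 - s) / a\<close>, and the limit follows from \<open>(\<Sum>s=1..a. s ^ j) / a ^ (j + 1) \<longlonglongrightarrow> 1 / (j + 1)\<close>.
\<close>

section \<open>Runs of larger entries\<close>

text \<open>The number of entries \<open>x\<close> of a list such that the maximal run of entries \<open>y\<close> with \<open>R x y\<close> directly
  behind \<open>x\<close> has length exactly \<open>k\<close>. It is used with \<open><\<close> for arrangements of distinct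
  cards and with \<open>\<le>\<close> for words.\<close>

primrec count_runs :: "('a \<Rightarrow> 'a \<Rightarrow> bool) \<Rightarrow> nat \<Rightarrow> 'a list \<Rightarrow> nat" where
  "count_runs R k [] = 0"
| "count_runs R k (x # xs) = of_bool (length (takeWhile (R x) xs) = k) + count_runs R k xs"

lemma card_eq_count_runs:
  assumes "distinct xs"
    and "\<And>us v vs. xs = us @ v # vs \<Longrightarrow> P v \<longleftrightarrow> length (takeWhile (R v) vs) = k"
  shows "card {v \<in> set xs. P v} = count_runs R k xs"
  using assms
proof (induction xs)
  case (Cons x xs)
  have IH: "card {v \<in> set xs. P v} = count_runs R k xs"
    using Cons.prems by (intro Cons.IH) (auto intro!: Cons.prems(2)[of "x # _"])
  have x: "P x \<longleftrightarrow> length (takeWhile (R x) xs) = k"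
    using Cons.prems(2)[of "[]"] by simp
  have "{v \<in> set (x # xs). P v} = (if P x then insert x else id) {v \<in> set xs. P v}"
    by auto
  then show ?case using IH x Cons.prems(1) by simp
qed simp

lemma count_runs_map:
  assumes "sorted_wrt (\<lambda>x y. R x y \<longleftrightarrow> Q (f x) (f y)) xs"
  shows "count_runs Q k (map f xs) = count_runs R k xs"
  using assms
proof (induction xs)
  case (Cons x xs)
  have "takeWhile (R x) xs = takeWhile (Q (f x) \<circ> f) xs"
    using Cons.prems by (intro takeWhile_cong) auto
  then show ?case using Cons by (simp add: takeWhile_map)
qed simp

section \<open>Descendants in the recursive tree\<close>

text \<open>Prepending the root to the arrangement makes the exceptional clause for parent \<open>1\<close> an instance of
  the general rule.\<close>

lemma tree_parent_eq_last:
  assumes "2 \<le> i"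
  shows "tree_parent \<gamma> i = last (filter (\<lambda>j. j < i) (takeWhile (\<lambda>j. j \<noteq> i) (1 # \<gamma>)))"
  using assms by (simp add: tree_parent_def Let_def)

lemma tree_parent_append:
  assumes "1 # \<gamma> = us @ i # vs" "i \<notin> set us" "2 \<le> i"
  shows "tree_parent \<gamma> i = last (filter (\<lambda>j. j < i) us)"
proof -
  have "takeWhile (\<lambda>j. j \<noteq> i) (us @ i # vs) = us"
    using assms(2) by (subst takeWhile_append2) auto
  then show ?thesis unfolding tree_parent_eq_last[OF assms(3)] assms(1) by simp
qed

text \<open>Each entry of the run behind \<open>v\<close> has its parent in the run or has parent \<open>v\<close>. Conversely, the entry
  that ends the run is smaller than \<open>v\<close>, so no node behind it has \<open>v\<close> or an entry of the run as its parent.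
  The root is included, as \<open>v\<close> may be the leading \<open>1\<close>.\<close>

lemma descendants_recursive_tree:
  assumes eq: "1 # \<gamma> = us @ v # vs" and dist: "distinct \<gamma>" and set: "set \<gamma> = {2..n}"
  shows "descendants (recursive_tree n \<gamma>) v = set (takeWhile (\<lambda>y. v < y) vs)"
proof -
  define zs where "zs = takeWhile (\<lambda>y. v < y) vs"
  define rs where "rs = dropWhile (\<lambda>y. v < y) vs"
  define T where "T = recursive_tree n \<gamma>"
  have vs: "vs = zs @ rs" by (simp add: zs_def rs_def)
  have zs_gt: "v < y" if "y \<in> set zs" for y
    using that unfolding zs_def by (auto dest: set_takeWhileD)
  have dist1: "distinct (1 # \<gamma>)" using dist set by auto
  have T_iff: "(u, i) \<in> T \<longleftrightarrow> i \<in> {2..n} \<and> u = tree_parent \<gamma> i" for u i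
    by (auto simp: T_def recursive_tree_def)
  have v_pos: "1 \<le> v"
  proof -
    have "v \<in> set (1 # \<gamma>)" unfolding eq by simp
    then show ?thesis using set by auto
  qed
  have down: "(v, w) \<in> T\<^sup>+" if "w \<in> set zs" for w
    using that
  proof (induction w rule: less_induct)
    case (less w)
    obtain as bs where zs: "zs = as @ w # bs" using less.prems by (auto dest: split_list)
    have eq': "1 # \<gamma> = (us @ v # as) @ w # (bs @ rs)" using eq vs zs by simp
    have w_gt: "v < w" using less.prems zs_gt by blast
    have w_n: "w \<in> {2..n}"
    proof -
      have "w \<in> set (1 # \<gamma>)" unfolding eq' by simp
      then show ?thesis using set w_gt v_pos by auto
    qed
    have "w \<notin> set (us @ v # as)" using dist1 unfolding eq' by simp
    then have par: "tree_parent \<gamma> w = last (filter (\<lambda>j. j < w) (us @ v # as))"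
      using tree_parent_append[OF eq'] w_n by simp
    also have "\<dots> = last (v # filter (\<lambda>j. j < w) as)" using w_gt by simp
    also have "\<dots> \<in> set (v # filter (\<lambda>j. j < w) as)" by (rule last_in_set) simp
    finally have "tree_parent \<gamma> w = v \<or> tree_parent \<gamma> w < w \<and> tree_parent \<gamma> w \<in> set zs"
      using zs by auto
    moreover have "(tree_parent \<gamma> w, w) \<in> T" using w_n T_iff by simp
    ultimately show ?case using less.IH by (meson r_into_trancl' trancl_into_trancl)
  qed
  have step: "i \<in> set zs" if "(u, i) \<in> T" "u \<in> insert v (set zs)" for u i
  proof (rule ccontr)
    assume i_zs: "i \<notin> set zs"
    have i: "2 \<le> i" "i \<in> set (1 # \<gamma>)" and u: "u = tree_parent \<gamma> i"
      using that(1) T_iff set by auto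
    obtain as bs where eq': "1 # \<gamma> = as @ i # bs" using i(2) by (meson split_list)
    have i_as: "i \<notin> set as" and i_bs: "i \<notin> set bs" using dist1 unfolding eq' by auto
    have par: "u = last (filter (\<lambda>j. j < i) as)"
      using tree_parent_append[OF eq' i_as i(1)] u by simp
    have "as \<noteq> []" using eq' i(1) by (cases as) auto
    then have "1 \<in> set as" using eq' by (cases as) auto
    then have "filter (\<lambda>j. j < i) as \<noteq> []" using i(1) by (force simp: filter_empty_conv)
    then have u_as: "u \<in> set as" "u < i"
      using last_in_set[of "filter (\<lambda>j. j < i) as"] par by auto
    \<comment> \<open>The node \<open>i\<close> stands after \<open>u\<close>, hence beyond the run, so the entry that ends the run
        separates \<open>u\<close> from \<open>i\<close> and is smaller than \<open>i\<close>.\<close>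
    have u_ge: "v \<le> u" using that(2) zs_gt by (auto intro: less_imp_le)
    have u_us: "u \<notin> set us" using that(2) dist1 unfolding eq vs by auto
    have "us @ (v # zs) @ rs = as @ i # bs" using eq eq' vs by simp
    moreover have "i \<notin> set (v # zs)" using i_zs u_as u_ge by simp
    moreover have "i \<notin> set us"
    proof
      assume "i \<in> set us"
      then obtain cs ds where us: "us = cs @ i # ds" by (meson split_list)
      have "cs @ i # (ds @ v # vs) = as @ i # bs" using eq eq' us by simp
      then have "cs = as" using append_Cons_eq_iff[OF i_as i_bs] by metis
      then show False using u_as(1) us u_us by simp
    qed
    moreover have "i \<in> set rs"
    proof -
      have "i \<in> set (us @ (v # zs) @ rs)" using calculation(1) by simp
      then show ?thesis using calculation(2,3) by auto
    qed
    ultimately obtain r rs' where rs: "rs = r # rs'" by (cases rs) auto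
    have "\<not> v < r" using rs unfolding rs_def by (metis hd_dropWhile list.discI list.sel(1))
    then have r_i: "r < i" using u_ge u_as by simp
    have "i \<in> set rs'" using \<open>i \<in> set rs\<close> rs r_i by auto
    then obtain cs ds where rs': "rs' = cs @ i # ds" by (meson split_list)
    have "(us @ (v # zs) @ r # cs) @ i # ds = as @ i # bs" using eq eq' vs rs rs' by simp
    then have as: "as = us @ (v # zs) @ r # cs"
      using append_Cons_eq_iff[OF i_as i_bs] by metis
    have "u = last (r # filter (\<lambda>j. j < i) cs)" using par r_i unfolding as by simp
    then have "u \<in> set (r # filter (\<lambda>j. j < i) cs)" using last_in_set by blast
    then have "u \<in> set rs" using rs rs' by auto
    moreover have "u \<notin> set rs" using that(2) dist1 unfolding eq vs by auto
    ultimately show False by blast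
  qed
  have up: "w \<in> set zs" if "(v, w) \<in> T\<^sup>+" for w
    using that by (induction rule: trancl_induct) (auto intro: step)
  show ?thesis unfolding descendants_def using down up by (auto simp: zs_def T_def)
qed

lemma num_with_descendants_recursive_tree:
  assumes "distinct \<gamma>" "set \<gamma> = {2..n}" "1 \<le> n"
  shows "num_with_descendants k n (recursive_tree n \<gamma>) = count_runs (<) k (1 # \<gamma>)"
proof -
  have "distinct (1 # \<gamma>)" using assms by auto
  moreover have "card (descendants (recursive_tree n \<gamma>) v) = k \<longleftrightarrow> length (takeWhile ((<) v) vs) = k"
    if "1 # \<gamma> = us @ v # vs" for us v vs
  proof -
    have "distinct (us @ v # vs)" using \<open>distinct (1 # \<gamma>)\<close> unfolding that .
    then have "distinct (takeWhile ((<) v) vs)" by simp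
    then show ?thesis
      using descendants_recursive_tree[OF that assms(1,2)] by (simp add: distinct_card)
  qed
  ultimately have "card {v \<in> set (1 # \<gamma>). card (descendants (recursive_tree n \<gamma>) v) = k}
      = count_runs (<) k (1 # \<gamma>)"
    by (rule card_eq_count_runs)
  moreover have "set (1 # \<gamma>) = {1..n}"
    unfolding list.set assms(2) using assms(3) by (intro equalityI subsetI) auto
  ultimately show ?thesis unfolding num_with_descendants_def by (simp only:)
qed

section \<open>Arrangements as words of pile indices\<close>

text \<open>The index of the pile that contains the card \<open>c\<close> when the pile sizes are \<open>b\<close>: pile \<open>s\<close> ends just
  before the card \<open>2 + (\<Sum>r=1..s. b r)\<close>. For numbers outside the deck the value is irrelevant.\<close>

definition pile_index :: "(nat \<Rightarrow> nat) \<Rightarrow> nat \<Rightarrow> nat" where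
  "pile_index b c = (LEAST s. c < 2 + (\<Sum>r=1..s. b r))"

lemma pile_index_less:
  assumes "b \<in> count_vectors a N" "c < 2 + N"
  shows "c < 2 + (\<Sum>r=1..pile_index b c. b r)"
proof -
  have "(\<Sum>r=1..a. b r) = N" using assms(1) by (simp only: count_vectors_def mem_Collect_eq)
  then have "c < 2 + (\<Sum>r=1..a. b r)" using assms(2) by (simp only:)
  then show ?thesis unfolding pile_index_def by (rule LeastI)
qed

lemma pile_index_le: "c < 2 + (\<Sum>r=1..s. b r) \<Longrightarrow> pile_index b c \<le> s"
  unfolding pile_index_def by (rule Least_le)

lemma pile_index_in:
  assumes "b \<in> count_vectors a N" "c \<in> {2..<2 + N}"
  shows "pile_index b c \<in> {1..a}"
proof -
  have "pile_index b c \<le> a" using assms by (intro pile_index_le) (auto simp: count_vectors_def)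
  moreover have "pile_index b c \<noteq> 0" using pile_index_less[OF assms(1), of c] assms(2)
    by (intro notI) auto
  ultimately show ?thesis by simp
qed

lemma pile_index_mono:
  assumes "b \<in> count_vectors a N" "d < 2 + N" "c \<le> d"
  shows "pile_index b c \<le> pile_index b d"
  by (rule pile_index_le[OF le_less_trans[OF assms(3) pile_index_less[OF assms(1,2)]]])

lemma in_set_pile_iff:
  "c \<in> set (pile b s) \<longleftrightarrow> 2 + (\<Sum>r=1..<s. b r) \<le> c \<and> c < 2 + (\<Sum>r=1..s. b r)"
  unfolding pile_def by (simp only: set_upt atLeastLessThan_iff)

lemma pile_index_eq_iff:
  assumes "b \<in> count_vectors a N" "c \<in> {2..<2 + N}" "s \<in> {1..a}"
  shows "pile_index b c = s \<longleftrightarrow> c \<in> set (pile b s)"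
proof
  assume s: "pile_index b c = s"
  have "\<not> c < 2 + (\<Sum>r=1..s - 1. b r)"
    using pile_index_le[of c b "s - 1"] s assms(3) by auto
  moreover have "{1..s - 1} = {1..<s}" using assms(3) by auto
  ultimately show "c \<in> set (pile b s)"
    using pile_index_less[OF assms(1), of c] s assms(2)
    by (simp add: in_set_pile_iff)
next
  assume c: "c \<in> set (pile b s)"
  then have "pile_index b c \<le> s" by (intro pile_index_le) (simp add: in_set_pile_iff)
  moreover have "\<not> pile_index b c < s"
  proof
    assume "pile_index b c < s"
    then have "(\<Sum>r=1..pile_index b c. b r) \<le> (\<Sum>r=1..<s. b r)" by (intro sum_mono2) auto
    then show False using pile_index_less[OF assms(1), of c] c assms(2) by (simp add: in_set_pile_iff)
  qed
  ultimately show "pile_index b c = s" by simp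
qed

lemma length_pile:
  assumes "1 \<le> s"
  shows "length (pile b s) = b s"
proof -
  have "{1..s} = insert s {1..<s}" using assms by auto
  then have "(\<Sum>r=1..s. b r) = b s + (\<Sum>r=1..<s. b r)" by simp
  then show ?thesis unfolding pile_def length_upt by simp
qed

lemma set_pile_subset:
  assumes "b \<in> count_vectors a N" "s \<in> {1..a}"
  shows "set (pile b s) \<subseteq> {2..<2 + N}"
proof -
  have "(\<Sum>r=1..s. b r) \<le> (\<Sum>r=1..a. b r)" using assms by (intro sum_mono2) auto
  then show ?thesis using assms(1) by (auto simp: in_set_pile_iff count_vectors_def)
qed

text \<open>Words of length \<open>N\<close> over the alphabet \<open>{1..a}\<close>.\<close>

definition words :: "nat \<Rightarrow> nat \<Rightarrow> nat list set" where
  "words a N = {w. set w \<subseteq> {1..a} \<and> length w = N}"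

lemma list_eq_if_filters_eq:
  assumes "map f xs = map f ys" "\<And>s. s \<in> f ` set xs \<Longrightarrow> filter (\<lambda>c. f c = s) xs = filter (\<lambda>c. f c = s) ys"
  shows "xs = ys"
  using assms
proof (induction xs arbitrary: ys)
  case (Cons x xs)
  obtain y zs where ys: "ys = y # zs" "f y = f x" "map f xs = map f zs"
    using Cons.prems(1) by (cases ys) auto
  have "x = y" using Cons.prems(2)[of "f x"] ys by simp
  moreover have "xs = zs"
  proof (rule Cons.IH[OF ys(3)])
    fix s assume "s \<in> f ` set xs"
    then have "filter (\<lambda>c. f c = s) (x # xs) = filter (\<lambda>c. f c = s) ys" by (intro Cons.prems(2)) auto
    then show "filter (\<lambda>c. f c = s) xs = filter (\<lambda>c. f c = s) zs"
      using ys(1) \<open>x = y\<close> by (simp split: if_splits)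
  qed
  ultimately show ?case using ys(1) by simp
qed simp

text \<open>Reading the word \<open>w\<close> and dealing the next card of pile \<open>L s\<close> for each letter \<open>s\<close> interleaves the
  piles.\<close>

lemma ex_interleaving:
  assumes "\<And>s. length (L s) = count_list w s" "\<And>s c. c \<in> set (L s) \<Longrightarrow> f c = s"
  shows "\<exists>xs. map f xs = w \<and> (\<forall>s. filter (\<lambda>c. f c = s) xs = L s)"
  using assms
proof (induction w arbitrary: L)
  case Nil
  then show ?case by (intro exI[of _ "[]"]) auto
next
  case (Cons x w)
  obtain y l where L: "L x = y # l" using Cons.prems(1)[of x] by (cases "L x") auto
  have fy: "f y = x" using Cons.prems(2)[of y x] L by simp
  have "\<exists>xs. map f xs = w \<and> (\<forall>s. filter (\<lambda>c. f c = s) xs = (L(x := l)) s)"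
  proof (rule Cons.IH)
    show "length ((L(x := l)) s) = count_list w s" for s
      using Cons.prems(1)[of s] L by (auto split: if_splits)
    show "f c = s" if "c \<in> set ((L(x := l)) s)" for c s
      using that Cons.prems(2)[of c s] L by (auto split: if_splits)
  qed
  then obtain xs where xs: "map f xs = w" "\<And>s. filter (\<lambda>c. f c = s) xs = (L(x := l)) s" by blast
  then show ?case using L fy by (intro exI[of _ "y # xs"]) auto
qed

lemma interleavings_filter:
  assumes "b \<in> count_vectors a N" "\<gamma> \<in> interleavings a (Suc N) b" "s \<in> {1..a}"
  shows "filter (\<lambda>c. pile_index b c = s) \<gamma> = pile b s"
proof -
  have "set \<gamma> = {2..<2 + N}" using assms(2) by (auto simp: interleavings_def permutations_of_set_def)
  then have "filter (\<lambda>c. pile_index b c = s) \<gamma> = filter (\<lambda>c. c \<in> set (pile b s)) \<gamma>"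
    using pile_index_eq_iff[OF assms(1) _ assms(3)] by (intro filter_cong) auto
  then show ?thesis using assms(2,3) by (simp add: interleavings_def)
qed

lemma bij_betw_interleavings_words:
  assumes b: "b \<in> count_vectors a N"
  shows "bij_betw (map (pile_index b)) (interleavings a (Suc N) b) {w \<in> words a N. count_list w = b}"
    (is "bij_betw ?m ?I ?W")
proof -
  have I_D: "set \<gamma> = {2..<2 + N}" "distinct \<gamma>" if "\<gamma> \<in> ?I" for \<gamma>
    using that by (auto simp: interleavings_def permutations_of_set_def)
  have b0: "b s = 0" if "s \<notin> {1..a}" for s using b that by (auto simp: count_vectors_def)
  have "inj_on ?m ?I"
  proof (rule inj_onI)
    fix \<gamma> \<delta> assume *: "\<gamma> \<in> ?I" "\<delta> \<in> ?I" "?m \<gamma> = ?m \<delta>"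
    show "\<gamma> = \<delta>"
    proof (rule list_eq_if_filters_eq[OF *(3)])
      fix s assume "s \<in> pile_index b ` set \<gamma>"
      then have "s \<in> {1..a}" using I_D[OF *(1)] pile_index_in[OF b] by auto
      then show "filter (\<lambda>c. pile_index b c = s) \<gamma> = filter (\<lambda>c. pile_index b c = s) \<delta>"
        using interleavings_filter[OF b] * by simp
    qed
  qed
  moreover have "?m \<gamma> \<in> ?W" if "\<gamma> \<in> ?I" for \<gamma>
  proof -
    have set: "set (?m \<gamma>) \<subseteq> {1..a}" using I_D[OF that] pile_index_in[OF b] by auto
    have "length \<gamma> = N" using I_D[OF that] distinct_card[of \<gamma>] by simp
    moreover have "count_list (?m \<gamma>) s = b s" for s
    proof (cases "s \<in> {1..a}")
      case True
      then have "length (filter (\<lambda>c. pile_index b c = s) \<gamma>) = b s"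
        using interleavings_filter[OF b that] length_pile by simp
      then show ?thesis by (simp add: count_list_eq_length_filter filter_map o_def eq_commute)
    next
      case False
      then have "s \<notin> set (?m \<gamma>)" using set by blast
      then show ?thesis using b0[OF False] count_list_0_iff by metis
    qed
    ultimately show ?thesis using set by (auto simp: words_def)
  qed
  moreover have "w \<in> ?m ` ?I" if w: "w \<in> ?W" for w
  proof -
    define L where "L s = (if s \<in> {1..a} then pile b s else [])" for s
    have "\<exists>\<gamma>. ?m \<gamma> = w \<and> (\<forall>s. filter (\<lambda>c. pile_index b c = s) \<gamma> = L s)"
    proof (rule ex_interleaving)
      show "length (L s) = count_list w s" for s
        using w b0[of s] by (auto simp: L_def length_pile)
      show "pile_index b c = s" if "c \<in> set (L s)" for c s
        using that set_pile_subset[OF b, of s] pile_index_eq_iff[OF b, of c s]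
        by (auto simp: L_def split: if_splits)
    qed
    then obtain \<gamma> where \<gamma>: "?m \<gamma> = w" "\<And>s. filter (\<lambda>c. pile_index b c = s) \<gamma> = L s" by blast
    have c_in: "c \<in> set \<gamma> \<longleftrightarrow> c \<in> set (L (pile_index b c))" for c
      by (simp flip: \<gamma>(2))
    have set: "set \<gamma> = {2..<2 + N}"
    proof (intro equalityI subsetI)
      fix c assume "c \<in> set \<gamma>"
      then show "c \<in> {2..<2 + N}"
        using c_in[of c] set_pile_subset[OF b, of "pile_index b c"]
        by (auto simp: L_def split: if_splits)
    next
      fix c assume c: "c \<in> {2..<2 + N}"
      then show "c \<in> set \<gamma>"
        using c_in[of c] pile_index_in[OF b c] pile_index_eq_iff[OF b c, of "pile_index b c"]
        by (simp add: L_def)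
    qed
    have "length \<gamma> = N" using \<gamma>(1) w by (auto simp: words_def)
    then have "distinct \<gamma>" using set by (intro card_distinct) simp
    moreover have "filter (\<lambda>c. c \<in> set (pile b s)) \<gamma> = pile b s" if s: "s \<in> {1..a}" for s
    proof -
      have "filter (\<lambda>c. c \<in> set (pile b s)) \<gamma> = filter (\<lambda>c. pile_index b c = s) \<gamma>"
        using pile_index_eq_iff[OF b _ s] set by (intro filter_cong) auto
      then show ?thesis using \<gamma>(2)[of s] s by (simp add: L_def)
    qed
    ultimately have "\<gamma> \<in> ?I" using set
      by (auto simp: interleavings_def permutations_of_set_def)
    then show ?thesis using \<gamma>(1) by blast
  qed
  ultimately show ?thesis unfolding bij_betw_def by blast
qed

text \<open>A list that increases along each class of a monotone map \<open>f\<close> is the standardization of its image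
  under \<open>f\<close>: equal values of \<open>f\<close> are ranked from left to right.\<close>

lemma sorted_wrt_filter_classes:
  fixes f :: "'a::linorder \<Rightarrow> 'b::linorder"
  assumes "\<And>s. s \<in> f ` set xs \<Longrightarrow> sorted (filter (\<lambda>c. f c = s) xs)" "distinct xs"
    and "\<And>x y. x \<in> set xs \<Longrightarrow> y \<in> set xs \<Longrightarrow> x \<le> y \<Longrightarrow> f x \<le> f y"
  shows "sorted_wrt (\<lambda>x y. x < y \<longleftrightarrow> f x \<le> f y) xs"
  using assms
proof (induction xs)
  case (Cons x xs)
  have "sorted_wrt (\<lambda>x y. x < y \<longleftrightarrow> f x \<le> f y) xs"
  proof (rule Cons.IH)
    fix s assume "s \<in> f ` set xs"
    then have "sorted (filter (\<lambda>c. f c = s) (x # xs))" by (intro Cons.prems(1)) auto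
    then show "sorted (filter (\<lambda>c. f c = s) xs)" by (simp split: if_splits)
  qed (use Cons.prems in auto)
  moreover have "x < y \<longleftrightarrow> f x \<le> f y" if y: "y \<in> set xs" for y
  proof
    assume "x < y"
    then show "f x \<le> f y" using Cons.prems(3)[of x y] y by simp
  next
    assume le: "f x \<le> f y"
    have "x \<noteq> y" using Cons.prems(2) y by auto
    moreover have "x \<le> y"
    proof (cases "f x = f y")
      case True
      have "sorted (filter (\<lambda>c. f c = f x) (x # xs))" by (intro Cons.prems(1)) auto
      then show ?thesis using y True by simp
    next
      case False
      then show ?thesis using le Cons.prems(3)[of y x] y by (metis list.set_intros linear order_antisym)
    qed
    ultimately show "x < y" by simp
  qed
  ultimately show ?case by simp
qed simp

lemma count_runs_interleaving:
  assumes b: "b \<in> count_vectors a N" and \<gamma>: "\<gamma> \<in> interleavings a (Suc N) b"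
  shows "count_runs (<) k \<gamma> = count_runs (\<le>) k (map (pile_index b) \<gamma>)"
proof (rule count_runs_map[symmetric], rule sorted_wrt_filter_classes)
  have set: "set \<gamma> = {2..<2 + N}" and "distinct \<gamma>"
    using \<gamma> by (auto simp: interleavings_def permutations_of_set_def)
  show "distinct \<gamma>" by fact
  fix s assume "s \<in> pile_index b ` set \<gamma>"
  then have "s \<in> {1..a}" using set pile_index_in[OF b] by auto
  then show "sorted (filter (\<lambda>c. pile_index b c = s) \<gamma>)"
    using interleavings_filter[OF b \<gamma>] unfolding pile_def by (simp only: sorted_upt)
next
  fix x y assume "x \<in> set \<gamma>" "y \<in> set \<gamma>" "x \<le> y"
  then show "pile_index b x \<le> pile_index b y"
    using \<gamma> by (intro pile_index_mono[OF b]) (auto simp: interleavings_def permutations_of_set_def)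
qed

section \<open>The shuffle as a word of independent letters\<close>

lemma finite_words: "finite (words a N)"
  unfolding words_def using finite_lists_length_eq[of "{1..a}" N] by simp

lemma words_0: "words a 0 = {[]}"
  by (auto simp: words_def)

lemma card_words_content:
  assumes "b \<in> count_vectors a N"
  shows "real (card {w \<in> words a N. count_list w = b}) = fact N / (\<Prod>s=1..a. fact (b s))"
proof -
  define M where "M = (\<Sum>s\<in>{1..a}. replicate_mset (b s) s)"
  have count: "count M s = b s" for s
    using assms by (auto simp: M_def count_sum count_vectors_def)
  have set: "set_mset M \<subseteq> {1..a}" by (auto simp: M_def set_mset_sum split: if_splits)
  have size: "size M = N" using assms by (simp add: M_def size_multiset_sum count_vectors_def)
  have "w \<in> words a N \<and> count_list w = b \<longleftrightarrow> mset w = M" for w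
  proof
    assume "w \<in> words a N \<and> count_list w = b"
    then show "mset w = M" by (auto intro!: multiset_eqI simp: count count_mset)
  next
    assume M: "mset w = M"
    have "length w = N" using size M by (metis size_mset)
    moreover have "set w \<subseteq> {1..a}" using set M by (metis set_mset_mset)
    moreover have "count_list w s = b s" for s using count M by (metis count_mset)
    ultimately show "w \<in> words a N \<and> count_list w = b" by (auto simp: words_def)
  qed
  then have "{w \<in> words a N. count_list w = b} = permutations_of_multiset M"
    by (auto simp: permutations_of_multiset_def)
  moreover have "(\<Prod>x\<in>set_mset M. fact (count M x)) = (\<Prod>s=1..a. fact (b s) :: nat)"
    unfolding count using set
    by (intro prod.mono_neutral_left) (auto simp: not_in_iff count)
  ultimately show ?thesis
    using card_permutations_of_multiset(1)[of M] card_permutations_of_multiset(2)[of M] size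
    by (simp add: real_of_nat_div)
qed

lemma prod_list_eq_prod_power:
  fixes p :: "nat \<Rightarrow> real"
  assumes "set w \<subseteq> {1..a}"
  shows "prod_list (map p w) = (\<Prod>s=1..a. p s ^ count_list w s)"
  using assms
proof (induction w)
  case (Cons x w)
  have "(\<Prod>s=1..a. p s ^ count_list (x # w) s) = (\<Prod>s=1..a. (if s = x then p x else 1) * p s ^ count_list w s)"
    by (intro prod.cong) auto
  then show ?case using Cons by (simp add: prod.distrib)
qed simp

text \<open>The shuffle has the law of the standardization of \<open>N\<close> independent letters with distribution \<open>p\<close>. This
  is expressed for statistics \<open>h\<close> of the arrangement that are a function \<open>F\<close> of the word of pile indices,
  where \<open>F\<close> does not depend on the pile sizes.\<close>

lemma expectation_biased_riffle_shuffle: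
  assumes p: "prob_vector a p"
    and hF: "\<And>b \<gamma>. b \<in> count_vectors a N \<Longrightarrow> \<gamma> \<in> interleavings a (Suc N) b \<Longrightarrow>
      h \<gamma> = F (map (pile_index b) \<gamma>)"
  shows "measure_pmf.expectation (biased_riffle_shuffle a p (Suc N)) h =
    (\<Sum>w\<in>words a N. prod_list (map p w) * F w)"
proof -
  let ?W = "\<lambda>b. {w \<in> words a N. count_list w = b}"
  have "set_pmf (multinomial_pmf a p N) \<subseteq> count_vectors a N"
    by (auto simp: set_pmf_iff pmf_multinomial_pmf[OF p] multinomial_mass_def split: if_splits)
  then have "measure_pmf.expectation (biased_riffle_shuffle a p (Suc N)) h =
      (\<Sum>b\<in>count_vectors a N. pmf (multinomial_pmf a p N) b *
        measure_pmf.expectation (pmf_of_set (interleavings a (Suc N) b)) h)"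
    unfolding biased_riffle_shuffle_def
    using interleavings_nonempty[of _ a "Suc N"]
    by (subst pmf_expectation_bind[of "count_vectors a N"])
      (auto simp: finite_count_vectors finite_interleavings)
  also have "\<dots> = (\<Sum>b\<in>count_vectors a N. \<Sum>w\<in>?W b. prod_list (map p w) * F w)"
  proof (rule sum.cong[OF refl])
    fix b assume b: "b \<in> count_vectors a N"
    let ?I = "interleavings a (Suc N) b"
    note bij = bij_betw_interleavings_words[OF b]
    have ne: "?I \<noteq> {}" using interleavings_nonempty[of b a "Suc N"] b by simp
    have card: "real (card ?I) = fact N / (\<Prod>s=1..a. fact (b s))"
      using card_words_content[OF b] bij_betw_same_card[OF bij] by simp
    have "sum h ?I = (\<Sum>\<gamma>\<in>?I. F (map (pile_index b) \<gamma>))"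
      using hF[OF b] by (intro sum.cong) auto
    also have "\<dots> = (\<Sum>w\<in>?W b. F w)" using bij by (rule sum.reindex_bij_betw)
    finally have "measure_pmf.expectation (pmf_of_set ?I) h = (\<Sum>w\<in>?W b. F w) / card ?I"
      using ne finite_interleavings by (simp add: integral_pmf_of_set)
    moreover have "pmf (multinomial_pmf a p N) b = real (card ?I) * (\<Prod>s=1..a. p s ^ b s)"
      using b card by (simp add: pmf_multinomial_pmf[OF p] multinomial_mass_def)
    moreover have "real (card ?I) \<noteq> 0" using ne finite_interleavings by simp
    ultimately have "pmf (multinomial_pmf a p N) b * measure_pmf.expectation (pmf_of_set ?I) h
        = (\<Prod>s=1..a. p s ^ b s) * (\<Sum>w\<in>?W b. F w)"
      by simp
    also have "\<dots> = (\<Sum>w\<in>?W b. (\<Prod>s=1..a. p s ^ b s) * F w)"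
      by (rule sum_distrib_left)
    also have "\<dots> = (\<Sum>w\<in>?W b. prod_list (map p w) * F w)"
      by (intro sum.cong refl) (auto simp: words_def prod_list_eq_prod_power)
    finally show "pmf (multinomial_pmf a p N) b * measure_pmf.expectation (pmf_of_set ?I) h
        = (\<Sum>w\<in>?W b. prod_list (map p w) * F w)" .
  qed
  also have "\<dots> = (\<Sum>w\<in>words a N. prod_list (map p w) * F w)"
  proof (rule sum.group[OF finite_words finite_count_vectors])
    show "count_list ` words a N \<subseteq> count_vectors a N"
    proof clarify
      fix w assume "w \<in> words a N"
      then have w: "set w \<subseteq> {1..a}" "length w = N" by (auto simp: words_def)
      have "count_list w s = 0" if "s \<notin> {1..a}" for s
        using w(1) that by (metis count_list_0_iff subsetD)
      moreover have "(\<Sum>s=1..a. count_list w s) = N"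
        using sum_count_set[OF w(1)] w(2) by simp
      ultimately show "count_list w \<in> count_vectors a N" by (auto simp: count_vectors_def)
    qed
  qed
  finally show ?thesis .
qed

section \<open>Expected number of runs in a random word\<close>

lemma sum_words_Suc:
  fixes p :: "nat \<Rightarrow> real"
  shows "(\<Sum>w\<in>words a (Suc N). prod_list (map p w) * F w) =
    (\<Sum>x=1..a. p x * (\<Sum>w\<in>words a N. prod_list (map p w) * F (x # w)))"
proof -
  have "words a (Suc N) = (\<lambda>(x, w). x # w) ` ({1..a} \<times> words a N)"
  proof (intro equalityI subsetI)
    fix v assume v: "v \<in> words a (Suc N)"
    then have "length v = Suc N" by (simp add: words_def)
    then obtain x w where xw: "v = x # w" by (cases v) simp_all
    then have "(x, w) \<in> {1..a} \<times> words a N" using v by (simp add: words_def)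
    then show "v \<in> (\<lambda>(x, w). x # w) ` ({1..a} \<times> words a N)"
      using xw by (intro image_eqI[of _ _ "(x, w)"]) simp_all
  qed (auto simp: words_def)
  moreover have "inj_on (\<lambda>(x, w). x # w) ({1..a} \<times> words a N)" by (rule inj_onI) auto
  ultimately have "(\<Sum>w\<in>words a (Suc N). prod_list (map p w) * F w) =
      (\<Sum>(x, w)\<in>{1..a} \<times> words a N. p x * (prod_list (map p w) * F (x # w)))"
    by (simp add: sum.reindex case_prod_unfold mult.assoc)
  also have "\<dots> = (\<Sum>x=1..a. \<Sum>w\<in>words a N. p x * (prod_list (map p w) * F (x # w)))"
    by (rule sum.cartesian_product[symmetric])
  finally show ?thesis by (simp only: sum_distrib_left)
qed

lemma sum_words_weight:
  fixes p :: "nat \<Rightarrow> real"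
  assumes "(\<Sum>s=1..a. p s) = 1"
  shows "(\<Sum>w\<in>words a N. prod_list (map p w)) = 1"
proof (induction N)
  case (Suc N)
  then show ?case using sum_words_Suc[where F = "\<lambda>_. 1"] assms by simp
qed (simp add: words_0)

text \<open>The run of independent letters that are at least \<open>x\<close> at the start of a word has a geometric length,
  cut off at the length \<open>N\<close> of the word.\<close>

lemma prob_run_length:
  fixes p :: "nat \<Rightarrow> real"
  assumes p: "(\<Sum>s=1..a. p s) = 1" and x: "x \<in> {1..a}"
  defines "q \<equiv> \<Sum>r=x..a. p r"
  shows "(\<Sum>w\<in>words a N. prod_list (map p w) * of_bool (length (takeWhile ((\<le>) x) w) = k)) =
    (if k < N then q ^ k - q ^ Suc k else of_bool (k = N) * q ^ k)"
proof (induction N arbitrary: k)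
  case 0
  then show ?case by (cases k) (auto simp: words_0)
next
  case (Suc N)
  let ?P = "\<lambda>N k. \<Sum>w\<in>words a N. prod_list (map p w) * of_bool (length (takeWhile ((\<le>) x) w) = k)"
  have split: "(\<Sum>s=1..a. p s * (if x \<le> s then c else d)) = q * c + (1 - q) * d" for c d :: real
  proof -
    have "{1..a} = {1..<x} \<union> {x..a}" using x by auto
    then have S: "sum g {1..a} = sum g {1..<x} + sum g {x..a}" for g :: "nat \<Rightarrow> real"
      by (simp add: sum.union_disjoint ivl_disj_int)
    have "(\<Sum>s=1..<x. p s) = 1 - q" using p S[of p] by (simp add: q_def)
    moreover have "(\<Sum>s=1..a. p s * (if x \<le> s then c else d)) = (\<Sum>s=1..<x. p s * d) + (\<Sum>s=x..a. p s * c)"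
      by (simp only: S) (intro arg_cong2[where f = "(+)"] sum.cong, auto)
    ultimately show ?thesis by (simp add: q_def flip: sum_distrib_right)
  qed
  show ?case
  proof (cases k)
    case 0
    have "?P (Suc N) k = (\<Sum>s=1..a. p s * (if x \<le> s then 0 else 1))"
      unfolding sum_words_Suc using 0 by (intro sum.cong refl) (auto simp: sum_words_weight[OF p])
    then show ?thesis using 0 by (simp only: split) simp
  next
    case (Suc k')
    have "?P (Suc N) k = (\<Sum>s=1..a. p s * (if x \<le> s then ?P N k' else 0))"
      unfolding sum_words_Suc using Suc by (intro sum.cong refl) auto
    also have "\<dots> = q * ?P N k'" by (simp only: split)
    finally show ?thesis using Suc Suc.IH[of k'] by (auto simp: algebra_simps)
  qed
qed

lemma sum_words_count_runs:
  fixes p :: "nat \<Rightarrow> real"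
  assumes p: "(\<Sum>s=1..a. p s) = 1"
  defines "q \<equiv> \<lambda>s. \<Sum>r=s..a. p r"
  shows "(\<Sum>w\<in>words a (k + 1 + m). prod_list (map p w) * real (count_runs (\<le>) k w)) =
    real m * (\<Sum>s=1..a. p s * (q s ^ k - q s ^ (k + 1))) + (\<Sum>s=1..a. p s * q s ^ k)"
proof -
  let ?E = "\<lambda>N. \<Sum>w\<in>words a N. prod_list (map p w) * real (count_runs (\<le>) k w)"
  have rec: "?E (Suc N) = (\<Sum>s=1..a. p s * (if k < N then q s ^ k - q s ^ Suc k
      else of_bool (k = N) * q s ^ k)) + ?E N" for N
  proof -
    have "?E (Suc N) = (\<Sum>s=1..a. p s * ((if k < N then q s ^ k - q s ^ Suc k
        else of_bool (k = N) * q s ^ k) + ?E N))"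
      unfolding sum_words_Suc
    proof (intro sum.cong refl arg_cong[where f = "(*) _"])
      fix s assume s: "s \<in> {1..a}"
      show "(\<Sum>w\<in>words a N. prod_list (map p w) * real (count_runs (\<le>) k (s # w))) =
          (if k < N then q s ^ k - q s ^ Suc k else of_bool (k = N) * q s ^ k) + ?E N"
        using prob_run_length[OF p s, where N = N and k = k] by (simp add: q_def distrib_left sum.distrib)
    qed
    then show ?thesis using p by (simp add: distrib_left sum.distrib flip: sum_distrib_right)
  qed
  have zero: "?E N = 0" if "N \<le> k" for N
    using that by (induction N) (simp_all add: words_0 rec)
  show ?thesis
    by (induction m) (simp_all add: rec zero distrib_right)
qed

lemma expectation_num_with_descendants:
  assumes p: "prob_vector a p" and n: "k + 2 \<le> n"
  defines "q \<equiv> \<lambda>s. \<Sum>r=s..a. p r"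
  shows "measure_pmf.expectation (biased_recursive_tree a p n) (\<lambda>T. real (num_with_descendants k n T)) =
      (real n - real k - 1) * (\<Sum>s=1..a. p s * (q s ^ k - q s ^ (k + 1)))
      + (\<Sum>s=1..a. p s * q s ^ (k + 1))"
proof -
  define m where "m = n - k - 2"
  then have m: "n = Suc (k + 1 + m)" using n by simp
  have "measure_pmf.expectation (biased_recursive_tree a p n) (\<lambda>T. real (num_with_descendants k n T))
     = measure_pmf.expectation (biased_riffle_shuffle a p (Suc (k + 1 + m)))
        (\<lambda>\<gamma>. real (num_with_descendants k n (recursive_tree n \<gamma>)))"
    unfolding biased_recursive_tree_def m by simp
  also have "\<dots> = (\<Sum>w\<in>words a (k + 1 + m). prod_list (map p w) * real (count_runs (\<le>) k w))"
  proof (rule expectation_biased_riffle_shuffle[OF p])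
    fix b \<gamma> assume b: "b \<in> count_vectors a (k + 1 + m)"
      and \<gamma>: "\<gamma> \<in> interleavings a (Suc (k + 1 + m)) b"
    have set: "set \<gamma> = {2..n}" and dist: "distinct \<gamma>"
      using \<gamma> m by (auto simp: interleavings_def permutations_of_set_def)
    \<comment> \<open>The root has all of \<open>\<gamma>\<close> as descendants, which are more than \<open>k\<close> nodes.\<close>
    have "takeWhile ((<) 1) \<gamma> = \<gamma>" using set by (intro takeWhile_eq_all_conv[THEN iffD2]) auto
    moreover have "length \<gamma> \<noteq> k" using set m distinct_card[OF dist] by simp
    ultimately have "count_runs (<) k (1 # \<gamma>) = count_runs (<) k \<gamma>"
      by (simp only: count_runs.simps of_bool_def) simp
    then show "real (num_with_descendants k n (recursive_tree n \<gamma>)) =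
        real (count_runs (\<le>) k (map (pile_index b) \<gamma>))"
      using num_with_descendants_recursive_tree[OF dist set, of k] n count_runs_interleaving[OF b \<gamma>]
      by simp
  qed
  also have "\<dots> = real m * (\<Sum>s=1..a. p s * (q s ^ k - q s ^ (k + 1))) + (\<Sum>s=1..a. p s * q s ^ k)"
    using sum_words_count_runs[of p a k m] p by (simp add: prob_vector_def q_def)
  also have "(\<Sum>s=1..a. p s * q s ^ k) =
      (\<Sum>s=1..a. p s * (q s ^ k - q s ^ (k + 1))) + (\<Sum>s=1..a. p s * q s ^ (k + 1))"
    by (simp add: algebra_simps flip: sum.distrib)
  finally show ?thesis using m by (simp add: algebra_simps)
qed

section \<open>The uniform case and its limit\<close>

lemma sum_uniform_tails:
  assumes "1 \<le> a"
  shows "(\<Sum>s=1..a. 1 / real a * (\<Sum>r=s..a. 1 / real a) ^ j)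
    = 1 / real a ^ (j + 1) * (\<Sum>s=1..a. real s ^ j)"
proof -
  have "(\<Sum>s=1..a. 1 / real a * (\<Sum>r=s..a. 1 / real a) ^ j) =
      (\<Sum>s=1..a. 1 / real a ^ (j + 1) * real (a + 1 - s) ^ j)"
    by (intro sum.cong refl) (simp add: power_divide)
  also have "\<dots> = (\<Sum>s=1..a. 1 / real a ^ (j + 1) * real s ^ j)"
    by (subst sum.atLeastAtMost_rev) (intro sum.cong refl, simp)
  finally show ?thesis by (simp add: sum_distrib_left)
qed

lemma expectation_a_recursive_tree:
  assumes "1 \<le> a" "k + 2 \<le> n"
  shows "measure_pmf.expectation (a_recursive_tree a n) (\<lambda>T. real (num_with_descendants k n T)) =
          (real n - real k - 1) *
            (1 / real a ^ (k + 1) * (\<Sum>s=1..a. real s ^ k)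
             - 1 / real a ^ (k + 2) * (\<Sum>s=1..a. real s ^ (k + 1)))
          + 1 / real a ^ (k + 2) * (\<Sum>s=1..a. real s ^ (k + 1))"
proof -
  have "prob_vector a (\<lambda>_. 1 / real a)" using assms by (simp add: prob_vector_def)
  from expectation_num_with_descendants[OF this assms(2)]
  show ?thesis
    unfolding a_recursive_tree_def right_diff_distrib[of "1 / real a"] sum_subtractf
      sum_uniform_tails[OF assms(1)]
    by simp
qed

text \<open>Both bounds telescope from \<open>(j + 1) x\<^sup>j \<le> (x + 1)\<^sup>j\<^sup>+\<^sup>1 - x\<^sup>j\<^sup>+\<^sup>1 \<le> (j + 1) (x + 1)\<^sup>j\<close> for \<open>x \<ge> 0\<close>.\<close>

lemma power_sum_bounds:
  "real a ^ (j + 1) \<le> real (j + 1) * (\<Sum>s=1..a. real s ^ j)"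
  "real (j + 1) * (\<Sum>s=1..a. real s ^ j) \<le> real (a + 1) ^ (j + 1) - 1"
proof -
  have step: "real (j + 1) * x ^ j \<le> (x + 1) ^ (j + 1) - x ^ (j + 1)"
    "(x + 1) ^ (j + 1) - x ^ (j + 1) \<le> real (j + 1) * (x + 1) ^ j" if "0 \<le> x" for x :: real
  proof -
    have eq: "(x + 1) ^ (j + 1) - x ^ (j + 1) = (\<Sum>i<Suc j. (x + 1) ^ i * x ^ (j - i))"
      using power_diff_sumr2[of "x + 1" "Suc j" x] by (simp add: mult.commute)
    have "x ^ j \<le> (x + 1) ^ i * x ^ (j - i)" if "i < Suc j" for i
    proof -
      have "x ^ i * x ^ (j - i) \<le> (x + 1) ^ i * x ^ (j - i)"
        using \<open>0 \<le> x\<close> by (intro mult_right_mono power_mono) auto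
      then show ?thesis using that by (simp flip: power_add)
    qed
    then show "real (j + 1) * x ^ j \<le> (x + 1) ^ (j + 1) - x ^ (j + 1)"
      unfolding eq using sum_bounded_below[of "{..<Suc j}" "x ^ j" "\<lambda>i. (x + 1) ^ i * x ^ (j - i)"] by simp
    have "(x + 1) ^ i * x ^ (j - i) \<le> (x + 1) ^ j" if "i < Suc j" for i
    proof -
      have "(x + 1) ^ i * x ^ (j - i) \<le> (x + 1) ^ i * (x + 1) ^ (j - i)"
        using \<open>0 \<le> x\<close> by (intro mult_left_mono power_mono) auto
      then show ?thesis using that by (simp flip: power_add)
    qed
    then show "(x + 1) ^ (j + 1) - x ^ (j + 1) \<le> real (j + 1) * (x + 1) ^ j"
      unfolding eq using sum_bounded_above[of "{..<Suc j}" "\<lambda>i. (x + 1) ^ i * x ^ (j - i)" "(x + 1) ^ j"] by simp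
  qed
  show "real a ^ (j + 1) \<le> real (j + 1) * (\<Sum>s=1..a. real s ^ j)"
  proof (induction a)
    case (Suc a)
    then show ?case using step(2)[of "real a"] by (simp add: distrib_left add_ac)
  qed simp
  show "real (j + 1) * (\<Sum>s=1..a. real s ^ j) \<le> real (a + 1) ^ (j + 1) - 1"
  proof (induction a)
    case (Suc a)
    then show ?case using step(1)[of "real (Suc a)"] by (simp add: distrib_left add_ac)
  qed simp
qed

lemma power_sum_tendsto:
  "(\<lambda>a. 1 / real a ^ (j + 1) * (\<Sum>s=1..a. real s ^ j)) \<longlonglongrightarrow> 1 / (real j + 1)"
proof (rule tendsto_sandwich)
  show "\<forall>\<^sub>F a in sequentially. 1 / (real j + 1) \<le> 1 / real a ^ (j + 1) * (\<Sum>s=1..a. real s ^ j)"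
    using eventually_gt_at_top[of 0]
  proof eventually_elim
    case (elim a)
    then show ?case using power_sum_bounds(1)[of a j] by (simp add: field_simps)
  qed
  show "\<forall>\<^sub>F a in sequentially. 1 / real a ^ (j + 1) * (\<Sum>s=1..a. real s ^ j)
      \<le> 1 / (real j + 1) * (1 + 1 / real a) ^ (j + 1)"
    using eventually_gt_at_top[of 0]
  proof eventually_elim
    case (elim a)
    have "1 + 1 / real a = real (a + 1) / real a" using elim by (simp add: field_simps)
    then have "(1 + 1 / real a) ^ (j + 1) = real (a + 1) ^ (j + 1) / real a ^ (j + 1)"
      by (simp only: power_divide)
    moreover have "1 / real a ^ (j + 1) * (\<Sum>s=1..a. real s ^ j)
        \<le> 1 / real a ^ (j + 1) * (real (a + 1) ^ (j + 1) / (real j + 1))"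
      using power_sum_bounds(2)[of j a]
      by (intro mult_left_mono) (simp_all add: pos_le_divide_eq mult.commute add.commute)
    ultimately show ?case by (simp add: mult.commute del: power_Suc)
  qed
  have "(\<lambda>a. 1 / (real j + 1) * (1 + 1 / real a) ^ (j + 1)) \<longlonglongrightarrow> 1 / (real j + 1) * (1 + 0) ^ (j + 1)"
    by (intro tendsto_intros lim_1_over_n)
  then show "(\<lambda>a. 1 / (real j + 1) * (1 + 1 / real a) ^ (j + 1)) \<longlonglongrightarrow> 1 / (real j + 1)" by simp
qed simp

theorem corollary4p2:
  fixes k n :: nat
  assumes "k + 2 \<le> n"
  shows
    "(\<forall>(a::nat) (p::nat \<Rightarrow> real). prob_vector a p \<and> (\<forall>s\<in>{1..a}. 0 < p s) \<longrightarrow>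
        measure_pmf.expectation (biased_recursive_tree a p n) (\<lambda>T. real (num_with_descendants k n T)) =
          (real n - real k - 1) *
            (\<Sum>s=1..a. p s * ((\<Sum>r=s..a. p r) ^ k - (\<Sum>r=s..a. p r) ^ (k + 1)))
          + (\<Sum>s=1..a. p s * (\<Sum>r=s..a. p r) ^ (k + 1))) \<and>
     (\<forall>a::nat. 2 \<le> a \<longrightarrow>
        measure_pmf.expectation (a_recursive_tree a n) (\<lambda>T. real (num_with_descendants k n T)) =
          (real n - real k - 1) *
            (1 / real a ^ (k + 1) * (\<Sum>s=1..a. real s ^ k)
             - 1 / real a ^ (k + 2) * (\<Sum>s=1..a. real s ^ (k + 1)))
          + 1 / real a ^ (k + 2) * (\<Sum>s=1..a. real s ^ (k + 1))) \<and>
     ((\<lambda>a. measure_pmf.expectation (a_recursive_tree a n) (\<lambda>T. real (num_with_descendants k n T)))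
        \<longlonglongrightarrow> real n / ((real k + 1) * (real k + 2)))"
proof (intro conjI allI impI)
  fix a :: nat and p :: "nat \<Rightarrow> real"
  assume "prob_vector a p \<and> (\<forall>s\<in>{1..a}. 0 < p s)"
  then show "measure_pmf.expectation (biased_recursive_tree a p n) (\<lambda>T. real (num_with_descendants k n T)) =
          (real n - real k - 1) *
            (\<Sum>s=1..a. p s * ((\<Sum>r=s..a. p r) ^ k - (\<Sum>r=s..a. p r) ^ (k + 1)))
          + (\<Sum>s=1..a. p s * (\<Sum>r=s..a. p r) ^ (k + 1))"
    using expectation_num_with_descendants[OF _ assms] by blast
next
  fix a :: nat
  assume "2 \<le> a"
  then show "measure_pmf.expectation (a_recursive_tree a n) (\<lambda>T. real (num_with_descendants k n T)) =
          (real n - real k - 1) *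
            (1 / real a ^ (k + 1) * (\<Sum>s=1..a. real s ^ k)
             - 1 / real a ^ (k + 2) * (\<Sum>s=1..a. real s ^ (k + 1)))
          + 1 / real a ^ (k + 2) * (\<Sum>s=1..a. real s ^ (k + 1))"
    by (intro expectation_a_recursive_tree assms) simp
next
  let ?E = "\<lambda>a. measure_pmf.expectation (a_recursive_tree a n) (\<lambda>T. real (num_with_descendants k n T))"
  let ?A = "\<lambda>j a. 1 / real a ^ (j + 1) * (\<Sum>s=1..a. real s ^ j)"
  have lim: "(\<lambda>a. (real n - real k - 1) * (?A k a - ?A (k + 1) a) + ?A (k + 1) a)
      \<longlonglongrightarrow> (real n - real k - 1) * (1 / (real k + 1) - 1 / (real (k + 1) + 1)) + 1 / (real (k + 1) + 1)"
    by (intro tendsto_intros power_sum_tendsto)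
  have ev: "\<forall>\<^sub>F a in sequentially.
      (real n - real k - 1) * (?A k a - ?A (k + 1) a) + ?A (k + 1) a = ?E a"
    using eventually_ge_at_top[of 1]
  proof eventually_elim
    case (elim a)
    show ?case unfolding expectation_a_recursive_tree[OF elim assms] by simp
  qed
  have eq: "(real n - real k - 1) * (1 / (real k + 1) - 1 / (real (k + 1) + 1)) + 1 / (real (k + 1) + 1)
      = real n / ((real k + 1) * (real k + 2))"
    by (simp add: divide_simps)
  show "?E \<longlonglongrightarrow> real n / ((real k + 1) * (real k + 2))"
    using Lim_transform_eventually[OF lim ev] unfolding eq .
qed

end
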